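(* Let $\mathcal{K}\subseteq\mathbb{R}^n$ be a nonempty closed convex cone, $\mathsf{A}\in\mathcal{S}^n$, $\mathbf{a}\in\mathbb{R}^n$, $\mathsf{F}\in\mathbb{R}^{m\times n}$ with rows $\mathbf{f}_1^{\mathsf T},\dots,\mathbf{f}_m^{\mathsf T}$, and $\mathbf{d}=(d_1,\dots,d_m)^{\mathsf T}\in\mathbb{R}^m$. Consider the quadratic problem $$(Q)\quad\inf_{\mathbf{x}\in\mathcal{K}}\{\mathbf{x}^{\mathsf T}\mathsf{A}\mathbf{x}+2\mathbf{a}^{\mathsf T}\mathbf{x}:\mathsf{F}\mathbf{x}\leq\mathbf{d}\}$$ and its sparse relaxation $$(R)\quad\inf_{\mathsf{X},\mathbf{x},\mathbf{z}_i,y_i,Y_i}\left\{\mathsf{A}\bullet\mathsf{X}+2\mathbf{a}^{\mathsf T}\mathbf{x}:\begin{array}{l}\mathbf{f}_i^{\mathsf T}\mathbf{x}+y_i=d_i,\\ \mathbf{f}_i\mathbf{f}_i^{\mathsf T}\bullet\mathsf{X}+2\mathbf{f}_i^{\mathsf T}\mathbf{z}_i+Y_i=d_i^2,\\ \mathsf{M}_i:=\begin{bmatrix}1&\mathbf{x}^{\mathsf T}&y_i\\ \mathbf{x}&\mathsf{X}&\mathbf{z}_i\\ y_i&\mathbf{z}_i^{\mathsf T}&Y_i\end{bmatrix}\in\mathcal{CPP}(\mathbb{R}_+\times\mathcal{K}\times\mathbb{R}_+),\end{array}\ i=1,\dots,m\right\}.$$ Let $\mathsf{X}\in\mathcal{S}^n$,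 $\mathbf{x}\in\mathbb{R}^n$, $\mathbf{z}_i\in\mathbb{R}^n$, $y_i\in\mathbb{R}$, $Y_i\in\mathbb{R}$, $i=1,\dots,m$, be an optimal solution of $(R)$, and let $\mathsf{M}_i\in\mathcal{S}^{n+2}$ be the corresponding matrix blocks. Then the optimal value of $(R)$ equals the optimal value of $(Q)$ if one of the following conditions holds: a) There are a vector $\mathbf{u}\in\mathrm{int}(\mathcal{K}^* )$ and numbers $w_i>0$, $\alpha_i>0$, $i=1,\dots,m$, such that for $\mathbf{v}_i=[-1,\alpha_i\mathbf{u}^{\mathsf T},w_i]^{\mathsf T}\in\mathbb{R}^{n+2}$ we have $\mathsf{M}_i\mathbf{v}_i=\mathbf{0}$ for all $i=1,\dots,m$. b) There is a vector $\mathbf{v}=[-1,\mathbf{u}^{\mathsf T}]^{\mathsf T}\in\mathbb{R}^{n+1}$ in the kernel of the matrix $\begin{bmatrix}1&\mathbf{x}^{\mathsf T}\\ \mathbf{x}&\mathsf{X}\end{bmatrix}$ with $\mathbf{u}\in\mathrm{int}(\mathcal{K}^* )$ such that, for all $\bar{\mathbf{x}}\in\mathbb{R}^n$, $\mathbf{u}^{\mathsf T}\bar{\mathbf{x}}=1$ and $\bar{\mathbf{x}}\in\mathcal{K}$ imply $\mathsf{F}\bar{\mathbf{x}}\leq\mathbf{d}$.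
   Context: $\mathcal{S}^k$ denotes the real symmetric $k\times k$ matrices; $\mathsf{A}\bullet\mathsf{B}=\mathrm{trace}(\mathsf{A}^{\mathsf T}\mathsf{B})$. $\mathcal{K}^*=\{\mathbf{x}:\mathbf{y}^{\mathsf T}\mathbf{x}\geq0\ \forall\mathbf{y}\in\mathcal{K}\}$ is the dual cone. For a nonempty closed convex cone $\mathcal{C}\subseteq\mathbb{R}^k$, $\mathcal{CPP}(\mathcal{C})=\mathrm{conv}\{\mathbf{x}\mathbf{x}^{\mathsf T}:\mathbf{x}\in\mathcal{C}\}\subseteq\mathcal{S}^k$. Vector inequalities are componentwise. *)

theory Defs
  imports "HOL-Analysis.Analysis"
begin

definition dual_cone :: "(real^'n) set \<Rightarrow> (real^'n) set" where
  "dual_cone K = {x. \<forall>y\<in>K. 0 \<le> y \<bullet> x}"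

definition outer :: "real^'k \<Rightarrow> real^'k^'k" where
  "outer x = (\<chi> i j. x $ i * x $ j)"

definition mat_inner :: "real^'k^'k \<Rightarrow> real^'k^'k \<Rightarrow> real" (infixl "\<bullet>\<^sub>F" 70) where
  "A \<bullet>\<^sub>F B = trace (transpose A ** B)"

definition CPP :: "(real^'k) set \<Rightarrow> (real^'k^'k) set" where
  "CPP C = convex hull (outer ` C)"

text \<open>
  The index types \<open>unit + 'n\<close> and \<open>unit + 'n + unit\<close> stand for the block decompositions
  of dimensions $n+1$ and $n+2$, in the order of the summands. Since \<open>vec_lambda\<close> indexes the rows
  of a matrix first, a block matrix is given below by its block rows.
\<close>

definition vec2 :: "real \<Rightarrow> real^'n \<Rightarrow> real^(unit + 'n)" where
  "vec2 p q = (\<chi> k. case k of Inl _ \<Rightarrow> p | Inr j \<Rightarrow> q $ j)"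

definition vec3 :: "real \<Rightarrow> real^'n \<Rightarrow> real \<Rightarrow> real^(unit + 'n + unit)" where
  "vec3 p q r = (\<chi> k. case k of Inl _ \<Rightarrow> p | Inr (Inl j) \<Rightarrow> q $ j | Inr (Inr _) \<Rightarrow> r)"

definition block2 :: "real^'n^'n \<Rightarrow> real^'n \<Rightarrow> real^(unit + 'n)^(unit + 'n)" where
  "block2 X x = (\<chi> k. case k of
      Inl _ \<Rightarrow> vec2 1 x
    | Inr i \<Rightarrow> vec2 (x $ i) (row i X))"

definition block3 ::
  "real^'n^'n \<Rightarrow> real^'n \<Rightarrow> real^'n \<Rightarrow> real \<Rightarrow> real \<Rightarrow>
   real^(unit + 'n + unit)^(unit + 'n + unit)" where
  "block3 X x z y Y = (\<chi> k. case k of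
      Inl _ \<Rightarrow> vec3 1 x y
    | Inr (Inl i) \<Rightarrow> vec3 (x $ i) (row i X) (z $ i)
    | Inr (Inr _) \<Rightarrow> vec3 y z Y)"

definition ext_cone :: "(real^'n) set \<Rightarrow> (real^(unit + 'n + unit)) set" where
  "ext_cone K = {vec3 p q r | p q r. 0 \<le> p \<and> q \<in> K \<and> 0 \<le> r}"

definition Q_feasible :: "(real^'n) set \<Rightarrow> real^'n^'m \<Rightarrow> real^'m \<Rightarrow> real^'n \<Rightarrow> bool" where
  "Q_feasible K F d x \<longleftrightarrow> x \<in> K \<and> F *v x \<le> d"

definition Q_objective :: "real^'n^'n \<Rightarrow> real^'n \<Rightarrow> real^'n \<Rightarrow> real" where
  "Q_objective A a x = x \<bullet> (A *v x) + 2 * (a \<bullet> x)"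

text \<open>
  Optimal values are taken in the extended reals, so that infeasible problems have value
  \<open>\<infinity>\<close> and unbounded ones \<open>-\<infinity>\<close>.
\<close>

definition Q_value ::
  "(real^'n) set \<Rightarrow> real^'n^'n \<Rightarrow> real^'n \<Rightarrow> real^'n^'m \<Rightarrow> real^'m \<Rightarrow> ereal" where
  "Q_value K A a F d = (INF x\<in>{x. Q_feasible K F d x}. ereal (Q_objective A a x))"

type_synonym ('n, 'm) R_point =
  "(real^'n^'n) \<times> (real^'n) \<times> ('m \<Rightarrow> real^'n) \<times> ('m \<Rightarrow> real) \<times> ('m \<Rightarrow> real)"

definition R_feasible ::
  "(real^'n) set \<Rightarrow> real^'n^'m \<Rightarrow> real^'m \<Rightarrow> ('n, 'm) R_point \<Rightarrow> bool" where
  "R_feasible K F d = (\<lambda>(X, x, z, y, Y).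
     transpose X = X \<and>
     (\<forall>i. row i F \<bullet> x + y i = d $ i \<and>
          outer (row i F) \<bullet>\<^sub>F X + 2 * (row i F \<bullet> z i) + Y i = (d $ i)\<^sup>2 \<and>
          block3 X x (z i) (y i) (Y i) \<in> CPP (ext_cone K)))"

definition R_objective :: "real^'n^'n \<Rightarrow> real^'n \<Rightarrow> ('n, 'm) R_point \<Rightarrow> real" where
  "R_objective A a = (\<lambda>(X, x, z, y, Y). A \<bullet>\<^sub>F X + 2 * (a \<bullet> x))"

definition R_value ::
  "(real^'n) set \<Rightarrow> real^'n^'n \<Rightarrow> real^'n \<Rightarrow> real^'n^'m \<Rightarrow> real^'m \<Rightarrow> ereal" where
  "R_value K A a F d =
     (INF s\<in>{s :: ('n, 'm) R_point. R_feasible K F d s}. ereal (R_objective A a s))"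

definition R_optimal ::
  "(real^'n) set \<Rightarrow> real^'n^'n \<Rightarrow> real^'n \<Rightarrow> real^'n^'m \<Rightarrow> real^'m \<Rightarrow> ('n, 'm) R_point \<Rightarrow> bool" where
  "R_optimal K A a F d s \<longleftrightarrow> is_arg_min (R_objective A a) (R_feasible K F d) s"

end

theory Submission
  imports Defs
begin

text \<open>
  Every feasible point of \<open>(Q)\<close> lifts to a feasible rank-one point of \<open>(R)\<close> with the same objective
  value, so \<open>(R)\<close> is a relaxation and only the reverse inequality is at stake. An element of a set
  \<open>CPP (ext_cone K)\<close> is a finite positive combination of matrices \<open>outer (vec3 p q r)\<close> with
  \<open>p \<ge> 0\<close>, \<open>q \<in> K\<close>, \<open>r \<ge> 0\<close>; call the triples \<open>(p, q, r)\<close> atoms of the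
  combination. If the quadratic form of the combination vanishes at a vector, then that vector is
  orthogonal to every atom (\<open>sum_outer_null_vector\<close>).

  Suppose that one block \<open>M\<^sub>j\<close> has a decomposition all of whose atoms satisfy
  \<open>F q \<le> p d\<close>, and \<open>q = 0\<close> whenever \<open>p = 0\<close>. Then the points \<open>q / p\<close> are feasible for
  \<open>(Q)\<close>, and the objective value of \<open>(R)\<close> is the average of their objective values with weights
  \<open>c p\<^sup>2\<close>, where \<open>c > 0\<close> is the coefficient of the atom; hence one of them is at least as good as the point of \<open>(R)\<close>
  (\<open>Q_value_le_of_atoms\<close>).

  Under condition b) the null vector gives \<open>u \<bullet> q = p\<close> for all atoms of any block. Since
  \<open>u\<close> is interior to the dual cone, \<open>p = 0\<close> forces \<open>q = 0\<close>, and \<open>q / p\<close> is feasible by assumption.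

  Under condition a) take \<open>j\<close> with \<open>\<alpha>\<^sub>j\<close> maximal. The two linear constraints of block \<open>i\<close> say that
  \<open>f\<^sub>i \<bullet> q + r - d\<^sub>i p\<close> has vanishing second moment over the atoms of \<open>M\<^sub>i\<close>. Eliminating \<open>r\<close> between
  this relation and the null vector \<open>v\<^sub>i\<close> yields
  \<open>\<alpha>\<^sub>i (u \<bullet> q) + w\<^sub>i (d\<^sub>i p - f\<^sub>i \<bullet> q) = p\<close>. This relation does not involve \<open>r\<close>, so it is a statement about
  \<open>X\<close> and \<open>x\<close> alone, which all blocks share; therefore it holds for the atoms of \<open>M\<^sub>j\<close> as well, for
  every \<open>i\<close>. There \<open>\<alpha>\<^sub>i (u \<bullet> q) \<le> \<alpha>\<^sub>j (u \<bullet> q) = p - w\<^sub>j r \<le> p\<close>, and so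
  \<open>f\<^sub>i \<bullet> q \<le> d\<^sub>i p\<close>.
\<close>

section \<open>Block vectors and block matrices\<close>

lemma sum_unit: "(\<Sum>k\<in>(UNIV :: unit set). f k) = f ()"
  by (simp add: UNIV_unit)

lemma sum_UNIV_Plus:
  fixes f :: "'a::finite + 'b::finite \<Rightarrow> 'c::comm_monoid_add"
  shows "(\<Sum>k\<in>UNIV. f k) = (\<Sum>i\<in>UNIV. f (Inl i)) + (\<Sum>j\<in>UNIV. f (Inr j))"
  by (simp flip: UNIV_Plus_UNIV add: sum.Plus comp_def)

lemma inner_vec3:
  "vec3 p q r \<bullet> vec3 p' q' r' = p * p' + q \<bullet> q' + r * r'"
  by (simp add: inner_vec_def vec3_def sum_UNIV_Plus sum_unit)

lemma inner_vec2:
  "vec2 p q \<bullet> vec2 p' q' = p * p' + q \<bullet> q'"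
  by (simp add: inner_vec_def vec2_def sum_UNIV_Plus sum_unit)

lemma matrix_vector_mult_nth: "(X *v c) $ k = X $ k \<bullet> (c :: real^'n)"
  by (simp add: inner_vec_def matrix_vector_mult_def)

lemma block3_mult_vec3:
  "block3 X x z y Y *v vec3 a b c
     = vec3 (a + x \<bullet> b + y * c) (a *\<^sub>R x + X *v b + c *\<^sub>R z) (y * a + z \<bullet> b + Y * c)"
  by (simp add: vec_eq_iff matrix_vector_mult_nth block3_def vec3_def[of "a + x \<bullet> b + y * c"]
      inner_vec3 row_def vec_lambda_eta split: sum.split)

lemma block2_mult_vec2:
  "block2 X x *v vec2 a b = vec2 (a + x \<bullet> b) (a *\<^sub>R x + X *v b)"
  by (simp add: vec_eq_iff matrix_vector_mult_nth block2_def vec2_def[of "a + x \<bullet> b"]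
      inner_vec2 row_def vec_lambda_eta split: sum.split)

lemma quadratic_form_block3:
  "vec3 a b c \<bullet> (block3 X x z y Y *v vec3 a b c)
     = a\<^sup>2 + 2 * a * (x \<bullet> b) + b \<bullet> (X *v b) + 2 * c * (z \<bullet> b) + 2 * a * c * y + c\<^sup>2 * Y"
  by (simp add: block3_mult_vec3 inner_vec3 inner_add_right inner_commute algebra_simps
      power2_eq_square)

lemma quadratic_form_block2:
  "vec2 a b \<bullet> (block2 X x *v vec2 a b) = a\<^sup>2 + 2 * a * (x \<bullet> b) + b \<bullet> (X *v b)"
  by (simp add: block2_mult_vec2 inner_vec2 inner_add_right inner_commute algebra_simps
      power2_eq_square)

lemma outer_mult: "outer v *v t = (v \<bullet> t) *\<^sub>R v"
  by (simp add: vec_eq_iff matrix_vector_mult_def outer_def inner_vec_def sum_distrib_left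
      algebra_simps)

lemma outer_vec3:
  "outer (vec3 1 x y) = block3 (outer x) x (y *\<^sub>R x) y (y\<^sup>2)"
  by (auto simp: vec_eq_iff outer_def block3_def vec3_def row_def power2_eq_square
      split: sum.split)

lemma mat_inner_eq_inner: "A \<bullet>\<^sub>F B = A \<bullet> B"
proof -
  have "A \<bullet>\<^sub>F B = (\<Sum>i\<in>UNIV. \<Sum>k\<in>UNIV. A $ k $ i * B $ k $ i)"
    by (simp add: mat_inner_def trace_def transpose_def matrix_matrix_mult_def)
  also have "\<dots> = A \<bullet> B"
    unfolding inner_vec_def by (subst sum.swap) simp
  finally show ?thesis .
qed

lemma inner_outer: "A \<bullet> outer q = q \<bullet> (A *v q)"
  by (simp add: inner_vec_def outer_def matrix_vector_mult_def sum_distrib_left algebra_simps)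

lemma outer_inner: "outer q \<bullet> A = q \<bullet> (A *v q)"
  by (metis inner_outer inner_commute)

lemma inner_pos_interior_dual_cone:
  assumes "u \<in> interior (dual_cone K)" "q \<in> K" "q \<noteq> 0"
  shows "0 < u \<bullet> q"
proof -
  obtain e where e: "e > 0" "cball u e \<subseteq> dual_cone K"
    using assms(1) by (auto simp: mem_interior_cball)
  define t where "t = e / norm q"
  have t: "t > 0" using e assms by (simp add: t_def)
  have "u - t *\<^sub>R q \<in> cball u e"
    using assms(3) e by (simp add: dist_norm t_def)
  then have "0 \<le> q \<bullet> (u - t *\<^sub>R q)"
    using e(2) assms(2) unfolding dual_cone_def by blast
  then have "t * (q \<bullet> q) \<le> u \<bullet> q"
    by (simp add: inner_diff_right inner_commute)
  moreover have "0 < t * (q \<bullet> q)" using t assms(3) by simp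
  ultimately show ?thesis by linarith
qed

section \<open>Atomic decompositions of completely positive matrices\<close>

lemma CPP_atoms:
  fixes M :: "real^'k^'k"
  assumes "M \<in> CPP C"
  obtains V c where "finite V" "V \<subseteq> C" "\<And>v. v \<in> V \<Longrightarrow> 0 < (c v :: real)"
    "M = (\<Sum>v\<in>V. c v *\<^sub>R outer v)"
proof -
  obtain T b where T: "finite T" "T \<subseteq> outer ` C" "\<forall>t\<in>T. 0 \<le> b t"
      "(\<Sum>t\<in>T. b t *\<^sub>R t) = M"
    using assms unfolding CPP_def convex_hull_explicit by blast
  obtain W where W: "W \<subseteq> C" "inj_on outer W" "T = outer ` W"
    using T(2) by (auto simp: subset_image_inj)
  have fin: "finite W" using T(1) W finite_image_iff by blast
  define V where "V = {v \<in> W. b (outer v) \<noteq> 0}"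
  show thesis
  proof
    show "finite V" "V \<subseteq> C" using fin W by (auto simp: V_def)
    show "0 < b (outer v)" if "v \<in> V" for v
      using that T(3) W(3) by (force simp: V_def less_le)
    have "M = (\<Sum>v\<in>W. b (outer v) *\<^sub>R outer v)"
      using T(4) W by (simp add: sum.reindex)
    also have "\<dots> = (\<Sum>v\<in>V. b (outer v) *\<^sub>R outer v)"
      using fin by (intro sum.mono_neutral_right) (auto simp: V_def)
    finally show "M = (\<Sum>v\<in>V. b (outer v) *\<^sub>R outer v)" .
  qed
qed

lemma sum_outer_null_vector:
  fixes t :: "real^'k"
  assumes "finite V" "\<And>v. v \<in> V \<Longrightarrow> 0 < (c v :: real)"
    and "t \<bullet> ((\<Sum>v\<in>V. c v *\<^sub>R outer v) *v t) = 0" and "v \<in> V"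
  shows "t \<bullet> v = 0"
proof -
  have "(\<Sum>v\<in>V. c v *\<^sub>R outer v) *v t = (\<Sum>v\<in>V. (c v *\<^sub>R outer v) *v t)"
    by (induction V rule: infinite_finite_induct)
      (simp_all add: matrix_vector_mult_add_rdistrib)
  then have "(\<Sum>v\<in>V. c v * (t \<bullet> v)\<^sup>2) = 0"
    using assms(3)
    by (simp add: inner_sum_right outer_mult power2_eq_square inner_commute
        scaleR_matrix_vector_assoc[symmetric] algebra_simps)
  moreover have "\<forall>v\<in>V. 0 \<le> c v * (t \<bullet> v)\<^sup>2"
    using assms(2) by (simp add: less_imp_le)
  ultimately have "c v * (t \<bullet> v)\<^sup>2 = 0"
    using assms(1,4) by (simp add: sum_nonneg_eq_0_iff)
  then show ?thesis using assms(2)[OF assms(4)] by simp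
qed

text \<open>
  A decomposition of a block into atoms \<open>(p, q, r)\<close> with weights \<open>c\<close>: the second moments of
  \<open>(p, q)\<close> are \<open>1\<close>, \<open>x\<close> and \<open>X\<close>, and the null vectors of the quadratic form of the
  block are orthogonal to all atoms.
\<close>

lemma block3_atoms:
  fixes X :: "real^'n^'n"
  assumes "block3 X x z y Y \<in> CPP (ext_cone K)"
  obtains V :: "(real^(unit + 'n + unit)) set" and c p q r
  where "finite V"
    and "\<And>v. v \<in> V \<Longrightarrow> 0 < (c v :: real) \<and> 0 \<le> p v \<and> q v \<in> K \<and> 0 \<le> (r v :: real)"
    and "(\<Sum>v\<in>V. c v * (p v)\<^sup>2) = 1"
    and "x = (\<Sum>v\<in>V. (c v * p v) *\<^sub>R q v)"
    and "X = (\<Sum>v\<in>V. c v *\<^sub>R outer (q v))"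
    and "\<And>t0 h g v. vec3 t0 h g \<bullet> (block3 X x z y Y *v vec3 t0 h g) = 0 \<Longrightarrow> v \<in> V \<Longrightarrow>
           t0 * p v + h \<bullet> q v + g * r v = 0"
proof -
  obtain V c where V: "finite V" "V \<subseteq> ext_cone K" "\<And>v. v \<in> V \<Longrightarrow> 0 < (c v :: real)"
      and M: "block3 X x z y Y = (\<Sum>v\<in>V. c v *\<^sub>R outer v)"
    by (rule CPP_atoms[OF assms]) blast
  define p where "p v = v $ Inl ()" for v :: "real^(unit + 'n + unit)"
  define q where "q v = (\<chi> j. v $ Inr (Inl j))" for v :: "real^(unit + 'n + unit)"
  define r where "r v = v $ Inr (Inr ())" for v :: "real^(unit + 'n + unit)"
  have v_eq: "v = vec3 (p v) (q v) (r v)" for v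
    by (auto simp: vec_eq_iff vec3_def p_def q_def r_def split: sum.split)
  have entry: "block3 X x z y Y $ k $ l = (\<Sum>v\<in>V. c v * (v $ k * v $ l))" for k l
    by (simp add: M outer_def)
  show thesis
  proof (rule that)
    show "finite V" by fact
    show "0 < c v \<and> 0 \<le> p v \<and> q v \<in> K \<and> 0 \<le> r v" if v: "v \<in> V" for v
    proof -
      obtain p' q' r' where e: "v = vec3 p' q' r'" "0 \<le> p'" "q' \<in> K" "0 \<le> r'"
        using v V(2) by (auto simp: ext_cone_def)
      have "p v = p'" "q v = q'" "r v = r'"
        by (simp_all add: e p_def q_def r_def vec3_def vec_lambda_eta)
      then show ?thesis using e V(3)[OF v] by simp
    qed
    show "(\<Sum>v\<in>V. c v * (p v)\<^sup>2) = 1"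
      using entry[of "Inl ()" "Inl ()"]
      by (simp add: block3_def vec3_def p_def power2_eq_square)
    show "x = (\<Sum>v\<in>V. (c v * p v) *\<^sub>R q v)"
      using entry[of "Inl ()" "Inr (Inl _)"]
      by (simp add: block3_def vec3_def p_def q_def vec_eq_iff mult.assoc)
    show "X = (\<Sum>v\<in>V. c v *\<^sub>R outer (q v))"
      using entry[of "Inr (Inl _)" "Inr (Inl _)"]
      by (simp add: block3_def vec3_def outer_def q_def vec_eq_iff row_def)
    show "t0 * p v + h \<bullet> q v + g * r v = 0"
      if "vec3 t0 h g \<bullet> (block3 X x z y Y *v vec3 t0 h g) = 0" "v \<in> V" for t0 h g v
    proof -
      have "vec3 t0 h g \<bullet> v = 0"
        by (rule sum_outer_null_vector[OF V(1) V(3) that(1)[unfolded M] that(2)])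
      then show ?thesis by (subst (asm) v_eq) (simp add: inner_vec3)
    qed
  qed
qed

section \<open>From atoms to feasible points\<close>

text \<open>
  The last two hypotheses on the atoms say that \<open>q / p\<close> is feasible for \<open>(Q)\<close> if \<open>p > 0\<close>, and that atoms
  with \<open>p = 0\<close> do not contribute to the objective.
\<close>

lemma Q_value_le_of_atoms:
  fixes q :: "'v \<Rightarrow> real^'n"
  assumes "cone K" "finite V"
    and atom: "\<And>v. v \<in> V \<Longrightarrow> 0 < (c v :: real) \<and> 0 \<le> p v \<and> q v \<in> K"
    and one: "(\<Sum>v\<in>V. c v * (p v)\<^sup>2) = 1"
    and x: "x = (\<Sum>v\<in>V. (c v * p v) *\<^sub>R q v)"
    and X: "X = (\<Sum>v\<in>V. c v *\<^sub>R outer (q v))"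
    and zero: "\<And>v. v \<in> V \<Longrightarrow> p v = 0 \<Longrightarrow> q v = 0"
    and feas: "\<And>v i. v \<in> V \<Longrightarrow> row i F \<bullet> q v \<le> d $ i * p v"
  shows "Q_value K A a F d \<le> ereal (A \<bullet>\<^sub>F X + 2 * (a \<bullet> x))"
proof -
  define b where "b = A \<bullet>\<^sub>F X + 2 * (a \<bullet> x)"
  define gap where "gap v = q v \<bullet> (A *v q v) + 2 * p v * (a \<bullet> q v) - b * (p v)\<^sup>2" for v
  have scaled: "gap v = (p v)\<^sup>2 * (Q_objective A a (q v /\<^sub>R p v) - b)" if "p v \<noteq> 0" for v
    using that by (simp add: gap_def Q_objective_def matrix_vector_mult_scaleR field_simps
        power2_eq_square)
  have b: "b = (\<Sum>v\<in>V. c v * (q v \<bullet> (A *v q v)) + c v * (2 * p v * (a \<bullet> q v)))"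
    by (simp add: b_def mat_inner_eq_inner X x inner_sum_right inner_outer sum.distrib
        sum_distrib_left algebra_simps)
  have "(\<Sum>v\<in>V. c v * gap v)
      = (\<Sum>v\<in>V. c v * (q v \<bullet> (A *v q v)) + c v * (2 * p v * (a \<bullet> q v)))
        - b * (\<Sum>v\<in>V. c v * (p v)\<^sup>2)"
    by (simp add: gap_def sum_distrib_left sum_subtractf[symmetric] algebra_simps)
  then have gap_sum: "(\<Sum>v\<in>V. c v * gap v) = 0"
    using b one by simp
  have "\<exists>v\<in>V. p v \<noteq> 0 \<and> gap v \<le> 0"
  proof (rule ccontr)
    assume "\<not> ?thesis"
    then have pos: "0 < gap v" if "v \<in> V" "p v \<noteq> 0" for v
      using that by force
    have "0 \<le> c v * gap v" if "v \<in> V" for v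
      using pos[OF that] zero[OF that] atom[OF that]
      by (cases "p v = 0") (auto simp: gap_def less_imp_le)
    then have "\<forall>v\<in>V. c v * gap v = 0"
      using gap_sum assms(2) by (simp add: sum_nonneg_eq_0_iff)
    then have "p v = 0" if "v \<in> V" for v
      using pos[OF that] atom[OF that] that by fastforce
    then show False using one by simp
  qed
  then obtain v where v: "v \<in> V" "p v \<noteq> 0" "gap v \<le> 0" by blast
  have p: "0 < p v" using v atom[OF v(1)] by simp
  have "Q_objective A a (q v /\<^sub>R p v) \<le> b"
    using scaled[OF v(2)] v(3) p by (simp add: mult_le_0_iff)
  moreover have "Q_feasible K F d (q v /\<^sub>R p v)"
  proof -
    have "q v /\<^sub>R p v \<in> K"
      using assms(1) atom[OF v(1)] p by (simp add: cone_def)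
    moreover have "(F *v (q v /\<^sub>R p v)) $ i \<le> d $ i" for i
      using feas[OF v(1), of i] p
      by (simp add: matrix_vector_mult_nth row_def vec_lambda_eta field_simps)
    ultimately show ?thesis by (simp add: Q_feasible_def less_eq_vec_def)
  qed
  ultimately show ?thesis
    unfolding Q_value_def b_def[symmetric] by (intro INF_lower2) auto
qed

lemma R_value_le_Q_value:
  fixes K :: "(real^'n) set" and F :: "real^'n^'m"
  shows "R_value K A a F d \<le> Q_value K A a F d"
  unfolding Q_value_def
proof (rule INF_greatest)
  fix t assume "t \<in> {x. Q_feasible K F d x}"
  then have t: "t \<in> K" "F *v t \<le> d" by (auto simp: Q_feasible_def)
  define s where "s i = d $ i - row i F \<bullet> t" for i
  let ?R = "(outer t, t, \<lambda>i. s i *\<^sub>R t, s, \<lambda>i. (s i)\<^sup>2)"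
  have s: "0 \<le> s i" for i
    using t(2) by (auto simp: s_def less_eq_vec_def matrix_vector_mult_nth row_def vec_lambda_eta)
  have "block3 (outer t) t (s i *\<^sub>R t) (s i) ((s i)\<^sup>2) \<in> CPP (ext_cone K)" for i
    unfolding CPP_def outer_vec3[symmetric]
    by (rule hull_inc, rule imageI) (use t s in \<open>force simp: ext_cone_def\<close>)
  moreover have "outer (row i F) \<bullet>\<^sub>F outer t + 2 * (row i F \<bullet> (s i *\<^sub>R t)) + (s i)\<^sup>2 = (d $ i)\<^sup>2" for i
    by (simp add: mat_inner_eq_inner inner_outer outer_mult s_def inner_commute
        power2_eq_square algebra_simps)
  moreover have "transpose (outer t) = outer t"
    by (simp add: transpose_def outer_def mult.commute)
  ultimately have "R_feasible K F d ?R"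
    by (simp add: R_feasible_def s_def)
  moreover have "R_objective A a ?R = Q_objective A a t"
    by (simp add: R_objective_def Q_objective_def mat_inner_eq_inner inner_outer)
  ultimately show "R_value K A a F d \<le> ereal (Q_objective A a t)"
    unfolding R_value_def by (intro INF_lower2[of ?R]) simp_all
qed

lemma R_value_eq_optimal:
  assumes "R_optimal K A a F d s"
  shows "R_value K A a F d = ereal (R_objective A a s)"
  unfolding R_value_def
proof (rule antisym)
  show "(INF s\<in>{s. R_feasible K F d s}. ereal (R_objective A a s)) \<le> ereal (R_objective A a s)"
    by (rule INF_lower) (use assms in \<open>simp add: R_optimal_def is_arg_min_def\<close>)
  show "ereal (R_objective A a s) \<le> (INF s\<in>{s. R_feasible K F d s}. ereal (R_objective A a s))"
    by (rule INF_greatest) (use assms in \<open>force simp: R_optimal_def is_arg_min_def not_less\<close>)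
qed

section \<open>Exactness under the two kernel conditions\<close>

lemma Q_value_le_of_block2_kernel:
  fixes K :: "(real^'n) set" and F :: "real^'n^'m" and z :: "'m \<Rightarrow> real^'n"
  assumes "cone K"
    and R: "R_feasible K F d (X, x, z, y, Y)"
    and u: "u \<in> interior (dual_cone K)"
    and ker: "block2 X x *v vec2 (- 1) u = 0"
    and slice: "\<And>x'. u \<bullet> x' = 1 \<Longrightarrow> x' \<in> K \<Longrightarrow> F *v x' \<le> d"
  shows "Q_value K A a F d \<le> ereal (A \<bullet>\<^sub>F X + 2 * (a \<bullet> x))"
proof -
  \<comment> \<open>Any block will do: the condition involves only \<open>X\<close> and \<open>x\<close>.\<close>
  fix j :: 'm
  have "block3 X x (z j) (y j) (Y j) \<in> CPP (ext_cone K)"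
    using R by (simp add: R_feasible_def)
  then obtain V :: "(real^(unit + 'n + unit)) set" and c p q r where V: "finite V"
    and atom: "\<And>v. v \<in> V \<Longrightarrow> 0 < (c v :: real) \<and> 0 \<le> p v \<and> q v \<in> K \<and> 0 \<le> (r v :: real)"
    and moments: "(\<Sum>v\<in>V. c v * (p v)\<^sup>2) = 1" "x = (\<Sum>v\<in>V. (c v * p v) *\<^sub>R q v)"
      "X = (\<Sum>v\<in>V. c v *\<^sub>R outer (q v))"
    and null: "\<And>t0 h g v. vec3 t0 h g \<bullet> (block3 X x (z j) (y j) (Y j) *v vec3 t0 h g) = 0
        \<Longrightarrow> v \<in> V \<Longrightarrow> t0 * p v + h \<bullet> q v + g * r v = 0"
    by (rule block3_atoms) blast
  have "vec2 (- 1) u \<bullet> (block2 X x *v vec2 (- 1) u) = 0"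
    by (simp add: ker)
  then have "vec3 (- 1) u 0 \<bullet> (block3 X x (z j) (y j) (Y j) *v vec3 (- 1) u 0) = 0"
    by (simp add: quadratic_form_block2 quadratic_form_block3)
  from null[OF this] have p_eq: "u \<bullet> q v = p v" if "v \<in> V" for v
    using that by simp
  have zero: "q v = 0" if "v \<in> V" "p v = 0" for v
    using inner_pos_interior_dual_cone[OF u, of "q v"] p_eq[OF that(1)] atom[OF that(1)] that(2)
    by force
  have "row i F \<bullet> q v \<le> d $ i * p v" if v: "v \<in> V" for v i
  proof (cases "p v = 0")
    case True
    then show ?thesis using zero[OF v] by simp
  next
    case False
    then have p: "0 < p v" using atom[OF v] by simp
    have "F *v (q v /\<^sub>R p v) \<le> d"
      using assms(1) atom[OF v] p p_eq[OF v] by (intro slice) (simp_all add: cone_def)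
    then have "(F *v (q v /\<^sub>R p v)) $ i \<le> d $ i"
      by (simp add: less_eq_vec_def)
    then show ?thesis
      using p by (simp add: matrix_vector_mult_nth row_def vec_lambda_eta field_simps)
  qed
  then show ?thesis
    using Q_value_le_of_atoms[OF assms(1) V _ moments zero] atom by blast
qed

lemma Q_value_le_of_block3_kernel:
  fixes K :: "(real^'n) set" and F :: "real^'n^'m" and z :: "'m \<Rightarrow> real^'n"
  assumes "cone K"
    and R: "R_feasible K F d (X, x, z, y, Y)"
    and u: "u \<in> interior (dual_cone K)"
    and w: "\<And>i. 0 < w i" and \<alpha>: "\<And>i. 0 < \<alpha> i"
    and ker: "\<And>i. block3 X x (z i) (y i) (Y i) *v vec3 (- 1) (\<alpha> i *\<^sub>R u) (w i) = 0"
  shows "Q_value K A a F d \<le> ereal (A \<bullet>\<^sub>F X + 2 * (a \<bullet> x))"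
proof -
  have cpp: "block3 X x (z i) (y i) (Y i) \<in> CPP (ext_cone K)" for i
    using R by (simp add: R_feasible_def)
  have lin: "row i F \<bullet> x + y i = d $ i"
    and quad: "outer (row i F) \<bullet>\<^sub>F X + 2 * (row i F \<bullet> z i) + Y i = (d $ i)\<^sup>2" for i
    using R by (simp_all add: R_feasible_def)
  \<comment> \<open>\<open>(e i, h i, 0)\<close> is the null vector \<open>(- 1, \<alpha>\<^sub>i u, w\<^sub>i)\<close> minus \<open>w\<^sub>i\<close> times the null vector
     \<open>(- d\<^sub>i, f\<^sub>i, 1)\<close> of block \<open>i\<close> that encodes its two linear constraints.\<close>
  define h where "h i = \<alpha> i *\<^sub>R u - w i *\<^sub>R row i F" for i
  define e where "e i = w i * d $ i - 1" for i
  have shared: "(e i)\<^sup>2 + 2 * e i * (x \<bullet> h i) + h i \<bullet> (X *v h i) = 0" for i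
  proof -
    let ?M = "block3 X x (z i) (y i) (Y i)"
    let ?t = "vec3 (- d $ i) (row i F) 1"
    have Mx: "(row i F) \<bullet> (X *v row i F) = (d $ i)\<^sup>2 - 2 * (z i \<bullet> row i F) - Y i"
      using quad[of i] by (simp add: mat_inner_eq_inner outer_inner inner_commute[of "row i F" "z i"])
    have y_eq: "y i = d $ i - x \<bullet> row i F"
      using lin[of i] by (simp add: inner_commute)
    have slack: "?t \<bullet> (?M *v ?t) = 0"
      unfolding quadratic_form_block3 Mx by (simp add: y_eq power2_eq_square algebra_simps)
    have kernel: "vec3 (- 1) (\<alpha> i *\<^sub>R u) (w i)
        \<bullet> (?M *v vec3 (- 1) (\<alpha> i *\<^sub>R u) (w i)) = 0"
      by (simp add: ker)
    obtain V :: "(real^(unit + 'n + unit)) set" and c p q r where V: "finite V"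
      and moments: "(\<Sum>v\<in>V. c v * (p v)\<^sup>2) = (1 :: real)"
        "x = (\<Sum>v\<in>V. (c v * p v) *\<^sub>R q v)" "X = (\<Sum>v\<in>V. c v *\<^sub>R outer (q v))"
      and null: "\<And>t0 h g v. vec3 t0 h g \<bullet> (?M *v vec3 t0 h g) = 0 \<Longrightarrow> v \<in> V \<Longrightarrow>
          t0 * p v + h \<bullet> q v + g * r v = 0"
      by (rule block3_atoms[OF cpp]) blast
    have "e i * p v + h i \<bullet> q v = 0" if v: "v \<in> V" for v
    proof -
      have "w i * (- d $ i * p v + row i F \<bullet> q v + r v) = 0"
        using null[OF slack v] by simp
      moreover have "- p v + \<alpha> i * (u \<bullet> q v) + w i * r v = 0"
        using null[OF kernel v] by simp
      ultimately show ?thesis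
        by (simp add: e_def h_def inner_diff_left algebra_simps)
    qed
    then have "0 = (\<Sum>v\<in>V. c v * (e i * p v + h i \<bullet> q v)\<^sup>2)" by simp
    also have "\<dots> = (e i)\<^sup>2 * (\<Sum>v\<in>V. c v * (p v)\<^sup>2)
        + 2 * e i * ((\<Sum>v\<in>V. (c v * p v) *\<^sub>R q v) \<bullet> h i)
        + outer (h i) \<bullet> (\<Sum>v\<in>V. c v *\<^sub>R outer (q v))"
      by (simp add: inner_sum_left inner_sum_right inner_outer outer_mult sum.distrib[symmetric]
          sum_distrib_left inner_commute power2_eq_square algebra_simps)
    finally show ?thesis
      unfolding moments(1) moments(2,3)[symmetric] outer_inner by simp
  qed
  have "Max (range \<alpha>) \<in> range \<alpha>" by (rule Max_in) simp_all
  then obtain j where "\<alpha> j = Max (range \<alpha>)" by (metis imageE)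
  then have j: "\<alpha> i \<le> \<alpha> j" for i by simp
  let ?M = "block3 X x (z j) (y j) (Y j)"
  obtain V :: "(real^(unit + 'n + unit)) set" and c p q r where V: "finite V"
    and atom: "\<And>v. v \<in> V \<Longrightarrow> 0 < (c v :: real) \<and> 0 \<le> p v \<and> q v \<in> K \<and> 0 \<le> (r v :: real)"
    and moments: "(\<Sum>v\<in>V. c v * (p v)\<^sup>2) = 1" "x = (\<Sum>v\<in>V. (c v * p v) *\<^sub>R q v)"
      "X = (\<Sum>v\<in>V. c v *\<^sub>R outer (q v))"
    and null: "\<And>t0 h g v. vec3 t0 h g \<bullet> (?M *v vec3 t0 h g) = 0
        \<Longrightarrow> v \<in> V \<Longrightarrow> t0 * p v + h \<bullet> q v + g * r v = 0"
    by (rule block3_atoms[OF cpp]) blast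
  have u_nonneg: "0 \<le> u \<bullet> q v" if "v \<in> V" for v
    using inner_pos_interior_dual_cone[OF u, of "q v"] atom[OF that] by (cases "q v = 0") auto
  have p_eq: "p v = \<alpha> j * (u \<bullet> q v) + w j * r v" if "v \<in> V" for v
    using null[of "- 1" "\<alpha> j *\<^sub>R u" "w j" v] that by (simp add: ker)
  have u_le: "\<alpha> j * (u \<bullet> q v) \<le> p v" if v: "v \<in> V" for v
  proof -
    have "0 \<le> w j * r v" using w[of j] atom[OF v] by simp
    then show ?thesis using p_eq[OF v] by simp
  qed
  have zero: "q v = 0" if v: "v \<in> V" "p v = 0" for v
  proof -
    have "u \<bullet> q v \<le> 0"
      using u_le[OF v(1)] v(2) \<alpha>[of j] by (simp add: mult_le_0_iff)
    then show ?thesis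
      using inner_pos_interior_dual_cone[OF u, of "q v"] atom[OF v(1)] by force
  qed
  have feas: "row i F \<bullet> q v \<le> d $ i * p v" if v: "v \<in> V" for v i
  proof -
    have "vec3 (e i) (h i) 0 \<bullet> (?M *v vec3 (e i) (h i) 0) = 0"
      using shared[of i] by (simp add: quadratic_form_block3)
    from null[OF this v]
    have "w i * (d $ i * p v - row i F \<bullet> q v) = p v - \<alpha> i * (u \<bullet> q v)"
      by (simp add: e_def h_def inner_diff_left algebra_simps)
    also have "\<dots> \<ge> 0"
      using mult_right_mono[OF j[of i] u_nonneg[OF v]] u_le[OF v] by simp
    finally show ?thesis using w[of i] by (simp add: zero_le_mult_iff)
  qed
  show ?thesis
    using Q_value_le_of_atoms[OF assms(1) V _ moments zero feas] atom by blast
qed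

theorem theorem17:
  fixes K :: "(real^'n) set"
    and A :: "real^'n^'n" and a :: "real^'n"
    and F :: "real^'n^'m" and d :: "real^'m"
    and X :: "real^'n^'n" and x :: "real^'n"
    and z :: "'m \<Rightarrow> real^'n" and y Y :: "'m \<Rightarrow> real"
  assumes "K \<noteq> {}" and "closed K" and "convex K" and "cone K"
    and "transpose A = A"
    and "R_optimal K A a F d (X, x, z, y, Y)"
    and "(\<exists>u w \<alpha>. u \<in> interior (dual_cone K) \<and>
            (\<forall>i. w i > 0) \<and> (\<forall>i. \<alpha> i > 0) \<and>
            (\<forall>i. block3 X x (z i) (y i) (Y i) *v vec3 (- 1) (\<alpha> i *\<^sub>R u) (w i) = 0))
       \<or> (\<exists>u. u \<in> interior (dual_cone K) \<and>
            block2 X x *v vec2 (- 1) u = 0 \<and>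
            (\<forall>x'. u \<bullet> x' = 1 \<and> x' \<in> K \<longrightarrow> F *v x' \<le> d))"
  shows "R_value K A a F d = Q_value K A a F d"
proof (rule antisym)
  show "R_value K A a F d \<le> Q_value K A a F d" by (rule R_value_le_Q_value)
  have R: "R_feasible K F d (X, x, z, y, Y)"
    using assms(6) by (simp add: R_optimal_def is_arg_min_def)
  have "Q_value K A a F d \<le> ereal (A \<bullet>\<^sub>F X + 2 * (a \<bullet> x))"
    using assms(7)
  proof (elim disjE exE conjE)
    fix u w \<alpha>
    assume "u \<in> interior (dual_cone K)" "\<forall>i. 0 < w i" "\<forall>i. 0 < \<alpha> i"
      "\<forall>i. block3 X x (z i) (y i) (Y i) *v vec3 (- 1) (\<alpha> i *\<^sub>R u) (w i) = 0"
    then show ?thesis by (intro Q_value_le_of_block3_kernel[OF assms(4) R, of u w \<alpha>]) auto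
  next
    fix u
    assume "u \<in> interior (dual_cone K)" "block2 X x *v vec2 (- 1) u = 0"
      "\<forall>x'. u \<bullet> x' = 1 \<and> x' \<in> K \<longrightarrow> F *v x' \<le> d"
    then show ?thesis by (intro Q_value_le_of_block2_kernel[OF assms(4) R, of u]) auto
  qed
  then show "Q_value K A a F d \<le> R_value K A a F d"
    using R_value_eq_optimal[OF assms(6)] by (simp add: R_objective_def)
qed

end
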